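(* Let $(\gamma,\nu):(I,t_0)\to\mathbb{R}^2\times S^1$ be a Legendre curve of the form $\gamma(t)=(x(t),z(t))$, $\nu(t)=(\cos\varphi(t),\sin\varphi(t))$ with curvature $(\dot\varphi,\beta)$. Let $J(t)=-\beta(t)x(t)$ and $H(t)=\frac12\bigl(x(t)\dot\varphi(t)+\beta(t)\cos\varphi(t)\bigr)$. Suppose that $x(t_0)>0$, that $\beta$ is given, and that there exists a smooth function $\alpha:(I,t_0)\to\mathbb{R}$ such that $H(t)=\alpha(t)J(t)$. Then, around $t_0$, $(\gamma,\nu)$ is given by $$x(t)=\bigl(F(t)^2+G(t)^2\bigr)^{1/2},\qquad z(t)=\int\frac{\beta(t)}{x(t)}\bigl(F(t)\sin\eta(t)-G(t)\cos\eta(t)\bigr)dt,$$ $$\cos\varphi(t)=\frac{F(t)\sin\eta(t)-G(t)\cos\eta(t)}{x(t)},\qquad \sin\varphi(t)=\frac{F(t)\cos\eta(t)+G(t)\sin\eta(t)}{x(t)},$$ where $$F(t)=-\int\beta(t)\cos\eta(t)\,dt,\qquad G(t)=-\int\beta(t)\sin\eta(t)\,dt,\qquad \eta(t)=2\int\alpha(t)\beta(t)\,dt$$ (for suitable choices of the integration constants).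
   Context: All maps are $C^\infty$; $(I,t_0)$ denotes an interval with base point $t_0\in I$ (the statement is local around $t_0$). A Legendre curve is a smooth map $(\gamma,\nu):I\to\mathbb{R}^2\times S^1$ with $\dot\gamma\cdot\nu=0$. With $\boldsymbol{\mu}=(-\sin\varphi,\cos\varphi)$ (the rotation of $\nu=(\cos\varphi,\sin\varphi)$ by $\pi/2$, where $\varphi$ is smooth), its curvature is $(\ell,\beta)=(\dot\nu\cdot\boldsymbol{\mu},\dot\gamma\cdot\boldsymbol{\mu})=(\dot\varphi,\beta)$, so $\dot x=-\beta\sin\varphi$, $\dot z=\beta\cos\varphi$. The functions $J$ and $H$ are the components $J^z_F$, $H^z_F$ of the curvature of the surface of revolution $(x(t)\cos\theta,x(t)\sin\theta,z(t))$ as a framed surface; where the surface is regular, $H/J$ is the mean curvature. Indefinite integrals denote antiderivatives. *)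

theory Defs
  imports "HOL-Analysis.Analysis"
begin

text \<open>
  Derivatives are taken within the interval \<open>I\<close>, so they are one-sided at an endpoint
  that belongs to \<open>I\<close>.
\<close>

definition deriv_on :: "real set \<Rightarrow> (real \<Rightarrow> 'a::real_normed_vector) \<Rightarrow> real \<Rightarrow> 'a" where
  "deriv_on I f = (\<lambda>t. vector_derivative f (at t within I))"

definition smooth_on :: "real set \<Rightarrow> (real \<Rightarrow> 'a::real_normed_vector) \<Rightarrow> bool" where
  "smooth_on I f \<longleftrightarrow> (\<forall>k. (deriv_on I ^^ k) f differentiable_on I)"

definition interval_with_base_point :: "real set \<Rightarrow> real \<Rightarrow> bool" where
  "interval_with_base_point I t0 \<longleftrightarrow> is_interval I \<and> interior I \<noteq> {} \<and> t0 \<in> I"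

text \<open>
  The norm and inner product of \<^typ>\<open>real \<times> real\<close> are the Euclidean ones.
\<close>

definition legendre_curve ::
  "real set \<Rightarrow> (real \<Rightarrow> real \<times> real) \<Rightarrow> (real \<Rightarrow> real \<times> real) \<Rightarrow> bool" where
  "legendre_curve I \<gamma> \<nu> \<longleftrightarrow>
     smooth_on I \<gamma> \<and> smooth_on I \<nu> \<and> (\<forall>t\<in>I. \<nu> t \<in> sphere 0 1) \<and>
     (\<forall>t\<in>I. deriv_on I \<gamma> t \<bullet> \<nu> t = 0)"

definition rot90 :: "real \<times> real \<Rightarrow> real \<times> real" where
  "rot90 v = (- snd v, fst v)"

definition legendre_curvature ::
  "real set \<Rightarrow> (real \<Rightarrow> real \<times> real) \<Rightarrow> (real \<Rightarrow> real \<times> real) \<Rightarrow> real \<Rightarrow> real \<times> real" where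
  "legendre_curvature I \<gamma> \<nu> t =
     (deriv_on I \<nu> t \<bullet> rot90 (\<nu> t), deriv_on I \<gamma> t \<bullet> rot90 (\<nu> t))"

text \<open>\<open>antiderivative_on S f A\<close>: the function \<open>A\<close> is one of the indefinite integrals of \<open>f\<close> on \<open>S\<close>.\<close>

definition antiderivative_on :: "real set \<Rightarrow> (real \<Rightarrow> real) \<Rightarrow> (real \<Rightarrow> real) \<Rightarrow> bool" where
  "antiderivative_on S f A \<longleftrightarrow> (\<forall>t\<in>S. (A has_real_derivative f t) (at t within S))"

end

theory Submission
  imports Defs
begin

text \<open>
  Write \<open>\<psi> = \<phi> + \<eta>\<close>. Inverting the rotation by \<open>\<eta>\<close> in the claimed formulas for \<open>x cos \<phi>\<close> and
  \<open>x sin \<phi>\<close> shows that they are equivalent to \<open>F = x sin \<psi>\<close> and \<open>G = - x cos \<psi>\<close>. So \<open>\<eta>\<close> may be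
  taken to be twice any antiderivative of \<open>\<alpha> \<beta>\<close>, after which \<open>F\<close> and \<open>G\<close> are \<^emph>\<open>defined\<close> by these
  two expressions; the formulas for \<open>x\<close>, \<open>cos \<phi>\<close> and \<open>sin \<phi>\<close> become trigonometric identities. What
  has content is that \<open>F\<close> and \<open>G\<close> have the required derivatives.

  The equation \<open>H = \<alpha> J\<close> reads \<open>x \<phi>' + \<beta> cos \<phi> = - 2 \<alpha> \<beta> x\<close>, that is \<open>x \<psi>' = - \<beta> cos \<phi>\<close>.
  Together with \<open>x' = - \<beta> sin \<phi>\<close> it says that the complex function \<open>G - i F = - x exp (i \<psi>)\<close> has
  derivative \<open>\<beta> (sin \<phi> + i cos \<phi>) exp (i \<psi>) = i \<beta> exp (i \<eta>)\<close>, in which \<open>x\<close> and \<open>\<phi>\<close> no longer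
  occur (lemma \<open>rotated_profile_derivatives\<close>). The nonlinear equation for the
  profile curve is thereby solved by two quadratures.

  Since \<open>x t0 > 0\<close> and \<open>x\<close> is continuous, \<open>x > 0\<close> near \<open>t0\<close>; there \<open>x\<close> is the square root
  \<open>sqrt (F\<^sup>2 + G\<^sup>2)\<close> with the right sign, and the division by \<open>x\<close> is legitimate.
\<close>

text \<open>
  The set \<open>I\<close> may be open or closed at either end, and \<open>t0\<close> may be an endpoint; a compact interval
  that contains all points of \<open>I\<close> near \<open>t0\<close> gives access to the fundamental theorem of calculus.
\<close>

lemma compact_interval_around_point:
  fixes I :: "real set"
  assumes "is_interval I" "t0 \<in> I"
  obtains a b \<epsilon> where "\<epsilon> > 0" "I \<inter> ball t0 \<epsilon> \<subseteq> {a..b}" "{a..b} \<subseteq> I"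
proof -
  obtain b d where b: "b \<in> I" "d > 0" "\<And>t. t \<in> I \<Longrightarrow> t < t0 + d \<Longrightarrow> t \<le> b"
  proof (cases "\<exists>b\<in>I. t0 < b")
    case True
    then obtain b where "b \<in> I" "t0 < b" by blast
    then show ?thesis by (intro that[of b "b - t0"]) auto
  next
    case False
    then show ?thesis using assms by (intro that[of t0 1]) (auto simp: not_less)
  qed
  obtain a e where a: "a \<in> I" "e > 0" "\<And>t. t \<in> I \<Longrightarrow> t0 - e < t \<Longrightarrow> a \<le> t"
  proof (cases "\<exists>a\<in>I. a < t0")
    case True
    then obtain a where "a \<in> I" "a < t0" by blast
    then show ?thesis by (intro that[of a "t0 - a"]) auto
  next
    case False
    then show ?thesis using assms by (intro that[of t0 1]) (auto simp: not_less)
  qed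
  show ?thesis
  proof (rule that)
    show "min d e > 0" using a b by simp
    show "I \<inter> ball t0 (min d e) \<subseteq> {a..b}"
      using a(3) b(3) by (auto simp: dist_real_def)
    show "{a..b} \<subseteq> I"
      using assms(1) a(1) b(1) by (meson atLeastAtMost_iff is_interval_1 subsetI)
  qed
qed

lemma local_antiderivative_exists:
  fixes f :: "real \<Rightarrow> real"
  assumes "is_interval I" "t0 \<in> I" "continuous_on I f"
  obtains A \<epsilon> where "\<epsilon> > 0" "antiderivative_on (I \<inter> ball t0 \<epsilon>) f A"
proof -
  obtain a b \<epsilon> where ab: "\<epsilon> > 0" "I \<inter> ball t0 \<epsilon> \<subseteq> {a..b}" "{a..b} \<subseteq> I"
    by (rule compact_interval_around_point[OF assms(1,2)])
  have "continuous_on {a..b} f" using assms(3) ab(3) continuous_on_subset by blast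
  then obtain A
    where A: "\<And>t. t \<in> {a..b} \<Longrightarrow> (A has_vector_derivative f t) (at t within {a..b})"
    using antiderivative_continuous by metis
  have "antiderivative_on (I \<inter> ball t0 \<epsilon>) f A"
    unfolding antiderivative_on_def has_real_derivative_iff_has_vector_derivative
  proof
    fix t assume "t \<in> I \<inter> ball t0 \<epsilon>"
    then have "(A has_vector_derivative f t) (at t within {a..b})"
      using A ab(2) by blast
    then show "(A has_vector_derivative f t) (at t within I \<inter> ball t0 \<epsilon>)"
      using ab(2) by (rule has_vector_derivative_within_subset)
  qed
  with ab(1) show thesis by (rule that)
qed

lemma antiderivative_on_subset:
  "antiderivative_on S f A \<Longrightarrow> T \<subseteq> S \<Longrightarrow> antiderivative_on T f A"
  unfolding antiderivative_on_def by (meson DERIV_subset subsetD)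

lemma smooth_on_has_vector_derivative:
  assumes "smooth_on I f" "t \<in> I"
  shows "(f has_vector_derivative deriv_on I f t) (at t within I)"
proof -
  have "(deriv_on I ^^ 0) f differentiable_on I" using assms(1) unfolding smooth_on_def by blast
  then show ?thesis
    using assms(2) by (simp add: differentiable_on_def deriv_on_def flip: vector_derivative_works)
qed

lemma smooth_on_imp_continuous_on: "smooth_on I f \<Longrightarrow> continuous_on I f"
  by (meson continuous_on_vector_derivative smooth_on_has_vector_derivative)

lemma smooth_on_imp_continuous_on_deriv_on:
  assumes "smooth_on I f"
  shows "continuous_on I (deriv_on I f)"
proof -
  have "(deriv_on I ^^ Suc 0) f differentiable_on I" using assms unfolding smooth_on_def by blast
  then show ?thesis by (simp add: differentiable_imp_continuous_on)
qed

text \<open>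
  The velocity of a Legendre curve has no component along \<open>\<nu>\<close>, so it is its component along the
  rotated normal times that unit vector.
\<close>

lemma legendre_curve_velocity:
  assumes "legendre_curve I \<gamma> \<nu>" "t \<in> I" "\<nu> t = (cos p, sin p)"
  defines "b \<equiv> snd (legendre_curvature I \<gamma> \<nu> t)"
  shows "deriv_on I \<gamma> t = (- b * sin p, b * cos p)"
proof -
  obtain u v where uv: "deriv_on I \<gamma> t = (u, v)" by fastforce
  have "deriv_on I \<gamma> t \<bullet> \<nu> t = 0"
    using assms(1,2) unfolding legendre_curve_def by blast
  then have orth: "u * cos p + v * sin p = 0"
    using uv assms(3) by simp
  have b: "b = - u * sin p + v * cos p"
    using uv assms(3) by (simp add: b_def legendre_curvature_def rot90_def)
  have one: "(sin p)\<^sup>2 + (cos p)\<^sup>2 = 1" by simp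
  have "u = - b * sin p"
    using orth b one by algebra
  moreover have "v = b * cos p"
    using orth b one by algebra
  ultimately show ?thesis using uv by simp
qed

lemma legendre_curve_coordinate_derivatives:
  assumes "legendre_curve I \<gamma> \<nu>" "\<And>t. t \<in> I \<Longrightarrow> \<gamma> t = (x t, z t)"
    and "t \<in> I" "\<nu> t = (cos p, sin p)" "snd (legendre_curvature I \<gamma> \<nu> t) = b"
  shows "(x has_real_derivative - b * sin p) (at t within I)"
    and "(z has_real_derivative b * cos p) (at t within I)"
proof -
  have "smooth_on I \<gamma>" using assms(1) unfolding legendre_curve_def by blast
  then have "(\<gamma> has_vector_derivative (- b * sin p, b * cos p)) (at t within I)"
    using smooth_on_has_vector_derivative legendre_curve_velocity assms(1,3,4,5) by metis
  then have "((\<lambda>t. (x t, z t)) has_vector_derivative (- b * sin p, b * cos p)) (at t within I)"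
    using assms(2,3) by (metis (no_types, lifting) has_vector_derivative_transform)
  from bounded_linear.has_vector_derivative[OF bounded_linear_fst this]
    bounded_linear.has_vector_derivative[OF bounded_linear_snd this]
  show "(x has_real_derivative - b * sin p) (at t within I)"
    and "(z has_real_derivative b * cos p) (at t within I)"
    by (simp_all add: has_real_derivative_iff_has_vector_derivative)
qed

lemma continuous_on_legendre_curvature_snd:
  assumes "legendre_curve I \<gamma> \<nu>"
  shows "continuous_on I (\<lambda>t. snd (legendre_curvature I \<gamma> \<nu> t))"
proof -
  have "smooth_on I \<gamma>" "smooth_on I \<nu>" using assms unfolding legendre_curve_def by auto
  then have "continuous_on I (deriv_on I \<gamma>)" "continuous_on I \<nu>"
    by (auto intro: smooth_on_imp_continuous_on smooth_on_imp_continuous_on_deriv_on)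
  then show ?thesis
    unfolding legendre_curvature_def rot90_def by (auto intro!: continuous_intros)
qed

text \<open>
  The hypothesis on \<open>x t * (p + e)\<close> is the prescribed mean curvature equation. It makes the radial
  and the angular part of the derivative combine by the addition theorems into functions of \<open>\<eta>\<close>
  alone.
\<close>

lemma rotated_profile_derivatives:
  assumes x: "(x has_real_derivative - b * sin (\<phi> t)) (at t within S)"
    and \<phi>: "(\<phi> has_real_derivative p) (at t within S)"
    and \<eta>: "(\<eta> has_real_derivative e) (at t within S)"
    and eq: "x t * (p + e) = - b * cos (\<phi> t)"
  shows "((\<lambda>t. x t * sin (\<phi> t + \<eta> t)) has_real_derivative - (b * cos (\<eta> t))) (at t within S)"
    and "((\<lambda>t. - (x t * cos (\<phi> t + \<eta> t))) has_real_derivative - (b * sin (\<eta> t))) (at t within S)"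
proof -
  have diff: "\<eta> t = (\<phi> t + \<eta> t) - \<phi> t" by simp
  have "((\<lambda>t. x t * sin (\<phi> t + \<eta> t)) has_real_derivative
      - b * sin (\<phi> t) * sin (\<phi> t + \<eta> t) + x t * (p + e) * cos (\<phi> t + \<eta> t)) (at t within S)"
    by (auto intro!: derivative_eq_intros x \<phi> \<eta>)
  also have "- b * sin (\<phi> t) * sin (\<phi> t + \<eta> t) + x t * (p + e) * cos (\<phi> t + \<eta> t)
      = - (b * cos (\<eta> t))"
    unfolding eq by (subst (3) diff, subst cos_diff) (simp add: algebra_simps)
  finally show "((\<lambda>t. x t * sin (\<phi> t + \<eta> t)) has_real_derivative - (b * cos (\<eta> t)))
      (at t within S)" .
  have "((\<lambda>t. - (x t * cos (\<phi> t + \<eta> t))) has_real_derivative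
      b * sin (\<phi> t) * cos (\<phi> t + \<eta> t) + x t * (p + e) * sin (\<phi> t + \<eta> t)) (at t within S)"
    by (auto intro!: derivative_eq_intros x \<phi> \<eta>)
  also have "b * sin (\<phi> t) * cos (\<phi> t + \<eta> t) + x t * (p + e) * sin (\<phi> t + \<eta> t)
      = - (b * sin (\<eta> t))"
    unfolding eq by (subst (3) diff, subst sin_diff) (simp add: algebra_simps)
  finally show "((\<lambda>t. - (x t * cos (\<phi> t + \<eta> t))) has_real_derivative - (b * sin (\<eta> t)))
      (at t within S)" .
qed

theorem theorem3p9:
  fixes I :: "real set" and t0 :: real
    and \<gamma> \<nu> :: "real \<Rightarrow> real \<times> real"
    and x z \<phi> \<beta> \<alpha> J H :: "real \<Rightarrow> real"
  assumes "interval_with_base_point I t0"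
    and "legendre_curve I \<gamma> \<nu>"
    and "\<And>t. t \<in> I \<Longrightarrow> \<gamma> t = (x t, z t)"
    and "smooth_on I \<phi>"
    and "\<And>t. t \<in> I \<Longrightarrow> \<nu> t = (cos (\<phi> t), sin (\<phi> t))"
    and "\<And>t. t \<in> I \<Longrightarrow> legendre_curvature I \<gamma> \<nu> t = (deriv_on I \<phi> t, \<beta> t)"
    and "\<And>t. t \<in> I \<Longrightarrow> J t = - \<beta> t * x t"
    and "\<And>t. t \<in> I \<Longrightarrow> H t = 1 / 2 * (x t * deriv_on I \<phi> t + \<beta> t * cos (\<phi> t))"
    and "x t0 > 0"
    and "smooth_on I \<alpha>"
    and "\<And>t. t \<in> I \<Longrightarrow> H t = \<alpha> t * J t"
  shows "\<exists>\<epsilon>>0. \<exists>A P Q F G \<eta>.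
      antiderivative_on (I \<inter> ball t0 \<epsilon>) (\<lambda>t. \<alpha> t * \<beta> t) A \<and>
      (\<forall>t \<in> I \<inter> ball t0 \<epsilon>. \<eta> t = 2 * A t) \<and>
      antiderivative_on (I \<inter> ball t0 \<epsilon>) (\<lambda>t. \<beta> t * cos (\<eta> t)) P \<and>
      (\<forall>t \<in> I \<inter> ball t0 \<epsilon>. F t = - P t) \<and>
      antiderivative_on (I \<inter> ball t0 \<epsilon>) (\<lambda>t. \<beta> t * sin (\<eta> t)) Q \<and>
      (\<forall>t \<in> I \<inter> ball t0 \<epsilon>. G t = - Q t) \<and>
      (\<forall>t \<in> I \<inter> ball t0 \<epsilon>. x t = sqrt ((F t)\<^sup>2 + (G t)\<^sup>2)) \<and>
      antiderivative_on (I \<inter> ball t0 \<epsilon>)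
        (\<lambda>t. \<beta> t / x t * (F t * sin (\<eta> t) - G t * cos (\<eta> t))) z \<and>
      (\<forall>t \<in> I \<inter> ball t0 \<epsilon>. cos (\<phi> t) = (F t * sin (\<eta> t) - G t * cos (\<eta> t)) / x t) \<and>
      (\<forall>t \<in> I \<inter> ball t0 \<epsilon>. sin (\<phi> t) = (F t * cos (\<eta> t) + G t * sin (\<eta> t)) / x t)"
proof -
  have I: "is_interval I" "t0 \<in> I"
    using assms(1) unfolding interval_with_base_point_def by auto
  have snd_curv: "snd (legendre_curvature I \<gamma> \<nu> t) = \<beta> t" if "t \<in> I" for t
    using assms(6)[OF that] by simp
  have dxz: "(x has_real_derivative - \<beta> t * sin (\<phi> t)) (at t within I)"
    "(z has_real_derivative \<beta> t * cos (\<phi> t)) (at t within I)" if "t \<in> I" for t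
    using legendre_curve_coordinate_derivatives
      [OF assms(2,3) that assms(5)[OF that] snd_curv[OF that]]
    by blast+
  have d\<phi>: "(\<phi> has_real_derivative deriv_on I \<phi> t) (at t within I)" if "t \<in> I" for t
    using smooth_on_has_vector_derivative[OF assms(4) that]
    by (simp add: has_real_derivative_iff_has_vector_derivative)
  have "continuous_on I \<beta>"
    using continuous_on_legendre_curvature_snd[OF assms(2)] snd_curv
    by (metis (no_types, lifting) continuous_on_cong)
  then have "continuous_on I (\<lambda>t. \<alpha> t * \<beta> t)"
    using smooth_on_imp_continuous_on[OF assms(10)] by (intro continuous_intros)
  then obtain A \<epsilon>1 where \<epsilon>1: "\<epsilon>1 > 0"
    and A1: "antiderivative_on (I \<inter> ball t0 \<epsilon>1) (\<lambda>t. \<alpha> t * \<beta> t) A"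
    using local_antiderivative_exists[OF I] by blast
  have "continuous_on I x"
    using dxz(1) by (meson DERIV_continuous continuous_on_eq_continuous_within)
  then obtain \<epsilon>2 where \<epsilon>2: "\<epsilon>2 > 0"
    and near: "\<And>t. t \<in> I \<Longrightarrow> dist t t0 < \<epsilon>2 \<Longrightarrow> dist (x t) (x t0) < x t0"
    using I(2) assms(9) unfolding continuous_on_iff by blast
  define \<epsilon> where "\<epsilon> = min \<epsilon>1 \<epsilon>2"
  define S where "S = I \<inter> ball t0 \<epsilon>"
  define \<eta> where "\<eta> t = 2 * A t" for t
  define F where "F t = x t * sin (\<phi> t + \<eta> t)" for t
  define G where "G t = - (x t * cos (\<phi> t + \<eta> t))" for t
  have \<epsilon>: "\<epsilon> > 0" using \<epsilon>1 \<epsilon>2 by (simp add: \<epsilon>_def)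
  have SI: "S \<subseteq> I" by (auto simp: S_def)
  have xpos: "x t > 0" if "t \<in> S" for t
    using near[of t] that by (auto simp: S_def \<epsilon>_def dist_commute dist_real_def abs_if split: if_splits)
  have A: "antiderivative_on S (\<lambda>t. \<alpha> t * \<beta> t) A"
    by (rule antiderivative_on_subset[OF A1]) (auto simp: S_def \<epsilon>_def)
  then have d\<eta>: "(\<eta> has_real_derivative 2 * (\<alpha> t * \<beta> t)) (at t within S)" if "t \<in> S" for t
    unfolding \<eta>_def using that by (auto simp: antiderivative_on_def intro!: DERIV_cmult)
  have eq: "x t * (deriv_on I \<phi> t + 2 * (\<alpha> t * \<beta> t)) = - \<beta> t * cos (\<phi> t)" if "t \<in> S" for t
    using assms(7,8,11)[of t] that SI by (auto simp: algebra_simps)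
  have dFG: "(F has_real_derivative - (\<beta> t * cos (\<eta> t))) (at t within S)"
    "(G has_real_derivative - (\<beta> t * sin (\<eta> t))) (at t within S)" if "t \<in> S" for t
  proof -
    have "t \<in> I" using that SI by blast
    note rotated_profile_derivatives[OF DERIV_subset[OF dxz(1)[OF this] SI]
        DERIV_subset[OF d\<phi>[OF this] SI] d\<eta>[OF that] eq[OF that]]
    then show "(F has_real_derivative - (\<beta> t * cos (\<eta> t))) (at t within S)"
      "(G has_real_derivative - (\<beta> t * sin (\<eta> t))) (at t within S)"
      unfolding F_def[abs_def] G_def[abs_def] by blast+
  qed
  have P: "antiderivative_on S (\<lambda>t. \<beta> t * cos (\<eta> t)) (\<lambda>t. - F t)"
    and Q: "antiderivative_on S (\<lambda>t. \<beta> t * sin (\<eta> t)) (\<lambda>t. - G t)"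
    unfolding antiderivative_on_def using dFG DERIV_minus by fastforce+
  have "(F t)\<^sup>2 + (G t)\<^sup>2 = (x t)\<^sup>2" for t
    using sin_cos_squared_add[of "\<phi> t + \<eta> t"]
    by (simp add: F_def G_def power_mult_distrib flip: distrib_left)
  then have x: "x t = sqrt ((F t)\<^sup>2 + (G t)\<^sup>2)" if "t \<in> S" for t
    using xpos[OF that] by simp
  \<comment> \<open>Rotating back by \<open>\<eta>\<close>: both formulas are addition theorems for \<open>\<phi> = (\<phi> + \<eta>) - \<eta>\<close>.\<close>
  have "F t * sin (\<eta> t) - G t * cos (\<eta> t) = x t * cos ((\<phi> t + \<eta> t) - \<eta> t)"
    and "F t * cos (\<eta> t) + G t * sin (\<eta> t) = x t * sin ((\<phi> t + \<eta> t) - \<eta> t)" for t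
    unfolding F_def G_def cos_diff sin_diff by (simp_all add: algebra_simps)
  then have xcos: "F t * sin (\<eta> t) - G t * cos (\<eta> t) = x t * cos (\<phi> t)"
    and xsin: "F t * cos (\<eta> t) + G t * sin (\<eta> t) = x t * sin (\<phi> t)" for t
    by simp_all
  have z: "antiderivative_on S (\<lambda>t. \<beta> t / x t * (F t * sin (\<eta> t) - G t * cos (\<eta> t))) z"
    unfolding antiderivative_on_def xcos
  proof
    fix t assume t: "t \<in> S"
    then have "(z has_real_derivative \<beta> t * cos (\<phi> t)) (at t within S)"
      using dxz(2) SI DERIV_subset by blast
    then show "(z has_real_derivative \<beta> t / x t * (x t * cos (\<phi> t))) (at t within S)"
      using xpos[OF t] by simp
  qed
  have c: "cos (\<phi> t) = (F t * sin (\<eta> t) - G t * cos (\<eta> t)) / x t"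
    and s: "sin (\<phi> t) = (F t * cos (\<eta> t) + G t * sin (\<eta> t)) / x t" if "t \<in> S" for t
    using xpos[OF that] by (simp_all add: xcos xsin)
  show ?thesis
  proof (rule exI[of _ \<epsilon>], rule conjI[OF \<epsilon>], fold S_def, rule exI[of _ A],
      rule exI[of _ "\<lambda>t. - F t"], rule exI[of _ "\<lambda>t. - G t"], rule exI[of _ F],
      rule exI[of _ G], rule exI[of _ \<eta>], intro conjI ballI)
    show "\<eta> t = 2 * A t" for t by (rule \<eta>_def)
    show "F t = - (- F t)" "G t = - (- G t)" for t by simp_all
  qed (fact A P Q x z c s)+
qed

end
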